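(* Let $1<p<\infty$ and let $T\in\mathcal L(\ell_p)$. If $\operatorname{Int}W_e(T)\neq\varnothing$, then $W(T)$ is star-shaped. More precisely, every point of $\operatorname{Int}W_e(T)$ is a star-centre of $W(T)$.
   Context: $\ell_p=\ell_p(\mathbb N)$ is the complex sequence space and $\mathcal L(\ell_p)$ its algebra of bounded linear operators; $\operatorname{Int}$ denotes the interior in $\mathbb C$. With $1/p+1/q=1$, the dual $(\ell_p)^*$ is identified with $\ell_q$ via $\langle x,y\rangle=\sum_j x_j\overline{y_j}$. For $x=(x_j)\in\ell_p$ put $J(x)=(x_j|x_j|^{p-2})_j\in\ell_q$ (with $0$ in the coordinates where $x_j=0$). The numerical range is $W(T)=\{\langle Tx,J(x)\rangle:\ x\in\ell_p,\ \|x\|_p=1\}$. The essential numerical range $W_e(T)$ is the set of all $\lambda\in\mathbb C$ for which there is a net (equivalently, a sequence) of unit vectors $x_\alpha\in\ell_p$ with $x_\alpha\to0$ weakly and $\langle Tx_\alpha,J(x_\alpha)\rangle\to\lambda$. A point $c$ of a set $A\subset\mathbb C$ is a star-centre of $A$ if $(1-t)c+tz\in A$ for all $z\in A$ and $t\in[0,1]$; $A$ is star-shaped if it has a star-centre. *)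

theory Defs
  imports "HOL-Analysis.Analysis"
begin

text \<open>
  The exponent is a real number, so \<open>\<ell>\<^sub>p\<close> is a carrier set inside the type of all complex sequences;
  operators and functionals are total functions of which only the values on the carrier matter.
\<close>

definition lp :: "real \<Rightarrow> (nat \<Rightarrow> complex) set" where
  "lp p = {x. summable (\<lambda>j. cmod (x j) powr p)}"

definition lp_norm :: "real \<Rightarrow> (nat \<Rightarrow> complex) \<Rightarrow> real" where
  "lp_norm p x = (\<Sum>j. cmod (x j) powr p) powr (1 / p)"

definition lp_operator :: "real \<Rightarrow> ((nat \<Rightarrow> complex) \<Rightarrow> (nat \<Rightarrow> complex)) \<Rightarrow> bool" where
  "lp_operator p T \<longleftrightarrow>
     (\<forall>x\<in>lp p. T x \<in> lp p) \<and>
     (\<forall>x\<in>lp p. \<forall>y\<in>lp p. T (\<lambda>j. x j + y j) = (\<lambda>j. T x j + T y j)) \<and>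
     (\<forall>a. \<forall>x\<in>lp p. T (\<lambda>j. a * x j) = (\<lambda>j. a * T x j)) \<and>
     (\<exists>K. \<forall>x\<in>lp p. lp_norm p (T x) \<le> K * lp_norm p x)"

definition lp_functional :: "real \<Rightarrow> ((nat \<Rightarrow> complex) \<Rightarrow> complex) \<Rightarrow> bool" where
  "lp_functional p f \<longleftrightarrow>
     (\<forall>x\<in>lp p. \<forall>y\<in>lp p. f (\<lambda>j. x j + y j) = f x + f y) \<and>
     (\<forall>a. \<forall>x\<in>lp p. f (\<lambda>j. a * x j) = a * f x) \<and>
     (\<exists>K. \<forall>x\<in>lp p. cmod (f x) \<le> K * lp_norm p x)"

definition lp_weakly_null :: "real \<Rightarrow> (nat \<Rightarrow> nat \<Rightarrow> complex) \<Rightarrow> bool" where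
  "lp_weakly_null p X \<longleftrightarrow> (\<forall>f. lp_functional p f \<longrightarrow> (\<lambda>n. f (X n)) \<longlonglongrightarrow> 0)"

definition pairing :: "(nat \<Rightarrow> complex) \<Rightarrow> (nat \<Rightarrow> complex) \<Rightarrow> complex" where
  "pairing x y = (\<Sum>j. x j * cnj (y j))"

text \<open>The factor \<open>x j\<close> makes the coordinate \<open>0\<close> where \<open>x j = 0\<close>, also for \<open>p < 2\<close>.\<close>

definition duality_map :: "real \<Rightarrow> (nat \<Rightarrow> complex) \<Rightarrow> (nat \<Rightarrow> complex)" where
  "duality_map p x = (\<lambda>j. x j * of_real (cmod (x j) powr (p - 2)))"

definition numerical_range ::
    "real \<Rightarrow> ((nat \<Rightarrow> complex) \<Rightarrow> (nat \<Rightarrow> complex)) \<Rightarrow> complex set" where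
  "numerical_range p T = {pairing (T x) (duality_map p x) | x. x \<in> lp p \<and> lp_norm p x = 1}"

definition essential_numerical_range ::
    "real \<Rightarrow> ((nat \<Rightarrow> complex) \<Rightarrow> (nat \<Rightarrow> complex)) \<Rightarrow> complex set" where
  "essential_numerical_range p T =
     {z. \<exists>X. (\<forall>n. X n \<in> lp p \<and> lp_norm p (X n) = 1) \<and> lp_weakly_null p X \<and>
             (\<lambda>n. pairing (T (X n)) (duality_map p (X n))) \<longlonglongrightarrow> z}"

definition star_centre :: "complex \<Rightarrow> complex set \<Rightarrow> bool" where
  "star_centre c A \<longleftrightarrow> c \<in> A \<and> (\<forall>z\<in>A. \<forall>t\<in>{0..1::real}. (1 - of_real t) * c + of_real t * z \<in> A)"

text \<open>Star-shapedness is the library predicate \<^const>\<open>starlike\<close>.\<close>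

lemma starlike_iff_star_centre: "starlike A \<longleftrightarrow> (\<exists>c. star_centre c A)"
proof -
  have "closed_segment c z \<subseteq> A \<longleftrightarrow>
      (\<forall>t\<in>{0..1::real}. (1 - of_real t) * c + of_real t * z \<in> A)" for c z
    by (fastforce simp: closed_segment_def scaleR_conv_of_real)
  then show ?thesis
    by (auto simp: starlike_def star_centre_def)
qed

end

theory Submission
  imports Defs
begin

text \<open>
  Write \<open>form x\<close> for \<open>\<langle>T x, J x\<rangle>\<close>, where \<open>J\<close> is the duality map. Let \<open>c\<close> be interior to the essential
  numerical range, let \<open>z\<close> be in the numerical range and \<open>0 \<le> t < 1\<close>; the point to be attained is
  \<open>m = (1 - t) c + t z\<close>.

  Vectors with disjoint supports do not interact in the norm or in the duality map: if
  \<open>u\<^sub>0, \<dots>, u\<^sub>n\<close> are unit vectors with disjoint supports and \<open>s\<^sub>0, \<dots>, s\<^sub>n\<close> are nonnegative with sum \<open>1\<close>,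
  then \<open>y = \<Sum> s\<^sub>k\<^bsup>1/p\<^esup> u\<^sub>k\<close> is a unit vector and \<open>J y = \<Sum> s\<^sub>k\<^bsup>(p-1)/p\<^esup> J u\<^sub>k\<close>, hence
  \<open>form y = \<Sum> s\<^sub>k form u\<^sub>k\<close> plus cross terms \<open>\<langle>T u\<^sub>k, J u\<^sub>l\<rangle>\<close> with coefficients at most \<open>1\<close>. Vectors which
  nearly attain a point of the numerical range may be taken finitely supported, and those which nearly
  attain a point of the essential numerical range may moreover be pushed arbitrarily far out, because
  a weakly null sequence tends to \<open>0\<close> in every coordinate, and so does its image under \<open>T\<close>. Far
  enough out in such a sequence, the cross terms with finitely many given blocks are small too
  (\<open>almost_decoupled_blocks\<close>). So, for points \<open>w\<^sub>0\<close> of the numerical range and \<open>w\<^sub>1, \<dots>, w\<^sub>n\<close> of the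
  essential numerical range, \<open>form\<close> takes values that differ from the convex combinations
  \<open>\<Sum> s\<^sub>k w\<^sub>k\<close> by a small error depending continuously on \<open>s\<close>.

  It remains to remove the error, which is where interiority is needed. If the weights can be chosen
  continuously so that \<open>\<Sum> s\<^sub>k(v) w\<^sub>k = v\<close> for all \<open>v\<close> in a disc around \<open>m\<close>, Brouwer's theorem gives a \<open>v\<close>
  at which the value is exactly \<open>m\<close> (\<open>convex_combination_in_numerical_range\<close>). Such
  weights exist for \<open>w\<^sub>0 = z\<close> and for \<open>w\<^sub>1, \<dots>, w\<^sub>4\<close> the corners of a small square centred at \<open>c\<close>.
\<close>

section \<open>The norm of a sequence and of its restrictions\<close>

text \<open>
  The \<open>p\<close>-th power of the norm, which is additive over disjoint supports.
\<close>

definition mass :: "real \<Rightarrow> (nat \<Rightarrow> complex) \<Rightarrow> real" where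
  "mass p x = (\<Sum>j. cmod (x j) powr p)"

definition restr :: "nat set \<Rightarrow> (nat \<Rightarrow> complex) \<Rightarrow> (nat \<Rightarrow> complex)" where
  "restr S x = (\<lambda>j. if j \<in> S then x j else 0)"

lemma mass_nonneg: "x \<in> lp p \<Longrightarrow> 0 \<le> mass p x"
  by (simp add: mass_def lp_def suminf_nonneg)

lemma restr_UNIV [simp]: "restr UNIV x = x"
  by (simp add: restr_def)

lemma lp_norm_nonneg: "0 \<le> lp_norm p x"
  by (simp add: lp_norm_def)

lemma lp_norm_eq_mass: "lp_norm p x = mass p x powr (1 / p)"
  by (simp add: lp_norm_def mass_def)

lemma lp_scale: "x \<in> lp p \<Longrightarrow> (\<lambda>j. a * x j) \<in> lp p"
  unfolding lp_def by (auto simp: norm_mult powr_mult summable_mult)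

context
  fixes p :: real
  assumes p: "1 < p"
begin

lemma lp_norm_powr: "x \<in> lp p \<Longrightarrow> lp_norm p x powr p = mass p x"
  using p mass_nonneg[of x p] by (simp add: lp_norm_def powr_powr mass_def)

lemma lp_norm_eq_1_iff: "x \<in> lp p \<Longrightarrow> lp_norm p x = 1 \<longleftrightarrow> mass p x = 1"
  by (metis lp_norm_powr lp_norm_eq_mass powr_one_eq_one)

lemma finite_support_lp:
  assumes "\<And>j. N \<le> j \<Longrightarrow> x j = 0"
  shows "x \<in> lp p"
proof -
  have "summable (\<lambda>j. cmod (x j) powr p)"
    by (rule summable_finite[of "{..<N}"]) (use assms in auto)
  then show ?thesis by (simp add: lp_def)
qed

lemma restr_lp: "x \<in> lp p \<Longrightarrow> restr S x \<in> lp p"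
  unfolding lp_def restr_def using p
  by (auto intro!: summable_comparison_test'[of "\<lambda>j. cmod (x j) powr p" 0])

lemma mass_restr_Un:
  assumes "x \<in> lp p" "A \<inter> B = {}"
  shows "mass p (restr (A \<union> B) x) = mass p (restr A x) + mass p (restr B x)"
proof -
  have "(\<lambda>j. cmod (restr (A \<union> B) x j) powr p) =
      (\<lambda>j. cmod (restr A x j) powr p + cmod (restr B x j) powr p)"
    using assms p by (auto simp: restr_def fun_eq_iff)
  then show ?thesis
    using restr_lp[OF assms(1), of A] restr_lp[OF assms(1), of B]
    by (simp add: mass_def lp_def suminf_add)
qed

lemma mass_restr_Compl:
  assumes "x \<in> lp p"
  shows "mass p (restr S x) + mass p (restr (- S) x) = mass p x"
  using mass_restr_Un[OF assms, of S "- S"] by simp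

lemma mass_restr_finite:
  assumes "finite S"
  shows "mass p (restr S x) = (\<Sum>j\<in>S. cmod (x j) powr p)"
proof -
  have "mass p (restr S x) = (\<Sum>j\<in>S. cmod (restr S x j) powr p)"
    unfolding mass_def using p assms by (intro suminf_finite) (auto simp: restr_def)
  then show ?thesis by (simp add: restr_def)
qed

lemma mass_tail_tendsto:
  assumes "x \<in> lp p"
  shows "(\<lambda>N. mass p (restr {N..} x)) \<longlonglongrightarrow> 0"
proof -
  have "(\<lambda>N. \<Sum>j<N. cmod (x j) powr p) \<longlonglongrightarrow> mass p x"
    using assms unfolding mass_def lp_def by (auto intro: summable_LIMSEQ)
  then have "(\<lambda>N. mass p x - (\<Sum>j<N. cmod (x j) powr p)) \<longlonglongrightarrow> mass p x - mass p x"
    by (intro tendsto_intros)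
  moreover have "mass p (restr {N..} x) = mass p x - (\<Sum>j<N. cmod (x j) powr p)" for N
    using mass_restr_Compl[OF assms, of "{..<N}"]
    by (simp add: mass_restr_finite)
  ultimately show ?thesis by simp
qed

lemma lp_norm_tendsto_0:
  assumes "\<And>n. X n \<in> lp p" "(\<lambda>n. mass p (X n)) \<longlonglongrightarrow> 0"
  shows "(\<lambda>n. lp_norm p (X n)) \<longlonglongrightarrow> 0"
proof -
  have "(\<lambda>n. mass p (X n) powr (1 / p)) \<longlonglongrightarrow> 0 powr (1 / p)"
    using assms p by (intro tendsto_powr') (auto simp: mass_nonneg)
  then show ?thesis by (simp add: lp_norm_eq_mass)
qed

lemma mass_scale: "x \<in> lp p \<Longrightarrow> mass p (\<lambda>j. a * x j) = cmod a powr p * mass p x"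
  unfolding mass_def lp_def by (simp add: norm_mult powr_mult suminf_mult)

lemma lp_norm_scale: "x \<in> lp p \<Longrightarrow> lp_norm p (\<lambda>j. a * x j) = cmod a * lp_norm p x"
  using p by (simp add: lp_norm_eq_mass mass_scale powr_mult powr_powr mass_nonneg)

lemma lp_norm_restr_le:
  assumes "x \<in> lp p"
  shows "lp_norm p (restr S x) \<le> lp_norm p x"
proof -
  have "mass p (restr S x) \<le> mass p x"
    using mass_restr_Compl[OF assms, of S] mass_nonneg[OF restr_lp[OF assms], of "- S"] by simp
  then show ?thesis
    using p mass_nonneg[OF restr_lp[OF assms], of S]
    by (auto simp: lp_norm_eq_mass intro!: powr_mono2)
qed

lemma norm_coordinate_le:
  assumes "x \<in> lp p"
  shows "cmod (x j) \<le> lp_norm p x"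
proof -
  have "cmod (x j) powr p = mass p (restr {j} x)"
    by (simp add: mass_restr_finite)
  also have "\<dots> \<le> mass p x"
    using mass_restr_Compl[OF assms, of "{j}"] mass_nonneg[OF restr_lp[OF assms], of "- {j}"] by linarith
  finally have "(cmod (x j) powr p) powr (1 / p) \<le> lp_norm p x"
    unfolding lp_norm_eq_mass using p by (intro powr_mono2) auto
  then show ?thesis using p by (simp add: powr_powr)
qed

end

section \<open>The duality map and the pairing\<close>

lemma norm_duality_map: "cmod (duality_map p y j) = cmod (y j) powr (p - 1)"
proof (cases "y j = 0")
  case False
  then have "cmod (y j) powr 1 * cmod (y j) powr (p - 2) = cmod (y j) powr (p - 1)"
    by (simp only: powr_add[symmetric]) simp
  then show ?thesis using False by (simp add: duality_map_def norm_mult)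
qed (simp add: duality_map_def)

lemma duality_map_scale:
  assumes "0 \<le> a"
  shows "duality_map p (\<lambda>j. of_real a * y j) j = of_real (a powr (p - 1)) * duality_map p y j"
proof (cases "a = 0")
  case False
  then have "a powr 1 * a powr (p - 2) = a powr (p - 1)"
    by (simp only: powr_add[symmetric]) simp
  then show ?thesis using False assms
    by (simp add: duality_map_def norm_mult powr_mult flip: of_real_mult)
qed (simp add: duality_map_def)

lemma duality_map_restr: "duality_map p (restr S x) = restr S (duality_map p x)"
  by (auto simp: duality_map_def restr_def)

lemma pairing_restr_left:
  "pairing (restr S x) (duality_map p (restr S y)) = pairing x (duality_map p (restr S y))"
  unfolding pairing_def duality_map_restr by (rule arg_cong[of _ _ suminf]) (auto simp: restr_def)

lemma pairing_finite_support:
  assumes "\<And>j. N \<le> j \<Longrightarrow> u j = 0"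
  shows "pairing x (duality_map p u) = (\<Sum>j<N. x j * cnj (duality_map p u j))"
  unfolding pairing_def using assms by (intro suminf_finite) (auto simp: duality_map_def)

context
  fixes p :: real
  assumes p: "1 < p"
begin

text \<open>
  Since \<open>J y\<close> has modulus \<open>\<bar>y\<bar>\<^bsup>p-1\<^esup>\<close> in every coordinate, Young's inequality for the exponents \<open>p\<close>
  and \<open>p / (p - 1)\<close> can be summed over the coordinates.
\<close>

lemma Young_pairing:
  assumes "x \<in> lp p" "y \<in> lp p"
  shows "summable (\<lambda>j. cmod (x j * cnj (duality_map p y j)))"
    and "(\<Sum>j. cmod (x j * cnj (duality_map p y j))) \<le> mass p x / p + mass p y * (1 - 1 / p)"
proof -
  have le: "cmod (x j * cnj (duality_map p y j)) \<le>
      cmod (x j) powr p / p + cmod (y j) powr p * (1 - 1 / p)" for j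
  proof -
    have "cmod (x j) * cmod (y j) powr (p - 1) \<le>
        cmod (x j) powr p / p + (cmod (y j) powr (p - 1)) powr (p / (p - 1)) / (p / (p - 1))"
      using p by (intro Youngs_inequality) (auto simp: field_simps)
    moreover have "(cmod (y j) powr (p - 1)) powr (p / (p - 1)) = cmod (y j) powr p"
      using p by (simp add: powr_powr)
    moreover have "u / (p / (p - 1)) = u * (1 - 1 / p)" for u :: real
      using p by (simp add: field_simps)
    ultimately show ?thesis
      by (simp add: norm_mult norm_duality_map)
  qed
  have s: "summable (\<lambda>j. cmod (x j) powr p / p + cmod (y j) powr p * (1 - 1 / p))"
    using assms unfolding lp_def by (auto intro!: summable_add summable_divide summable_mult2)
  show sum: "summable (\<lambda>j. cmod (x j * cnj (duality_map p y j)))"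
    by (rule summable_comparison_test'[OF s, of 0]) (use le in auto)
  have "(\<Sum>j. cmod (x j * cnj (duality_map p y j))) \<le>
      (\<Sum>j. cmod (x j) powr p / p + cmod (y j) powr p * (1 - 1 / p))"
    by (intro suminf_le le sum s)
  also have "\<dots> = mass p x / p + mass p y * (1 - 1 / p)"
    using assms unfolding lp_def mass_def
    by (simp add: suminf_add[symmetric] suminf_divide suminf_mult2 summable_divide summable_mult2)
  finally show "(\<Sum>j. cmod (x j * cnj (duality_map p y j))) \<le> mass p x / p + mass p y * (1 - 1 / p)" .
qed

lemma pairing_summable:
  assumes "x \<in> lp p" "y \<in> lp p"
  shows "summable (\<lambda>j. x j * cnj (duality_map p y j))"
  using Young_pairing(1)[OF assms] by (rule summable_norm_cancel)

lemma norm_pairing_le_Young: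
  assumes "x \<in> lp p" "y \<in> lp p"
  shows "cmod (pairing x (duality_map p y)) \<le> mass p x / p + mass p y * (1 - 1 / p)"
  unfolding pairing_def
  using summable_norm[OF Young_pairing(1)[OF assms]] Young_pairing(2)[OF assms]
  by linarith

lemma pairing_scale_left:
  assumes "x \<in> lp p" "y \<in> lp p"
  shows "pairing (\<lambda>j. a * x j) (duality_map p y) = a * pairing x (duality_map p y)"
  using pairing_summable[OF assms] unfolding pairing_def by (simp add: suminf_mult mult.assoc)

lemma pairing_scale_right:
  assumes "x \<in> lp p" "y \<in> lp p" "0 \<le> a"
  shows "pairing x (duality_map p (\<lambda>j. of_real a * y j)) =
    of_real (a powr (p - 1)) * pairing x (duality_map p y)"
proof -
  have "x j * cnj (duality_map p (\<lambda>j. of_real a * y j) j) =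
      of_real (a powr (p - 1)) * (x j * cnj (duality_map p y j))" for j
    unfolding duality_map_scale[OF assms(3)] by simp
  then show ?thesis
    unfolding pairing_def by (simp only: suminf_mult[OF pairing_summable[OF assms(1,2)]])
qed

lemma lp_norm_eq_0:
  assumes "x \<in> lp p" "lp_norm p x = 0"
  shows "x j = 0"
  using norm_coordinate_le[OF p assms(1), of j] assms(2) by simp

text \<open>
  For unit vectors the sum of Young's inequalities is at most \<open>1 / p + (1 - 1 / p) = 1\<close>; the general case
  follows because both sides are homogeneous of degree \<open>1\<close> in \<open>x\<close> and \<open>p - 1\<close> in \<open>y\<close>.
\<close>

lemma Holder_pairing:
  assumes "x \<in> lp p" "y \<in> lp p"
  shows "cmod (pairing x (duality_map p y)) \<le> lp_norm p x * lp_norm p y powr (p - 1)"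
proof (cases "lp_norm p x = 0 \<or> lp_norm p y = 0")
  case True
  then have "(\<lambda>j. x j * cnj (duality_map p y j)) = (\<lambda>j. 0)"
    using lp_norm_eq_0 assms by (auto simp: duality_map_def fun_eq_iff)
  then have "pairing x (duality_map p y) = 0"
    by (simp add: pairing_def)
  then show ?thesis by (simp add: lp_norm_nonneg)
next
  case False
  define a b where "a = lp_norm p x" and "b = lp_norm p y"
  have ab: "0 < a" "0 < b"
    using False lp_norm_nonneg[of p x] lp_norm_nonneg[of p y] by (auto simp: a_def b_def)
  let ?x = "\<lambda>j. of_real (1 / a) * x j" and ?y = "\<lambda>j. of_real (1 / b) * y j"
  have "lp_norm p ?x = 1" "lp_norm p ?y = 1"
    using ab lp_norm_scale[OF p assms(1), of "of_real (1 / a)"] lp_norm_scale[OF p assms(2), of "of_real (1 / b)"]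
    by (simp_all add: norm_divide flip: a_def b_def)
  then have m: "mass p ?x = 1" "mass p ?y = 1"
    using lp_norm_eq_1_iff[OF p lp_scale[OF assms(1)]] lp_norm_eq_1_iff[OF p lp_scale[OF assms(2)]]
    by blast+
  have "cmod (pairing ?x (duality_map p ?y)) \<le> 1"
    using norm_pairing_le_Young[OF lp_scale[OF assms(1)] lp_scale[OF assms(2)],
        of "of_real (1/a)" "of_real (1/b)"] m
    by simp
  also have "pairing ?x (duality_map p ?y) =
      of_real (1 / a) * of_real ((1 / b) powr (p - 1)) * pairing x (duality_map p y)"
  proof -
    have "0 \<le> 1 / b" using ab by simp
    from pairing_scale_right[OF lp_scale[OF assms(1)] assms(2) this, of "of_real (1 / a)"]
    show ?thesis
      by (simp only: pairing_scale_left[OF assms] mult.assoc mult.left_commute)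
  qed
  finally show ?thesis
    using ab by (simp add: norm_mult norm_divide powr_divide field_simps flip: a_def b_def)
qed

lemma pairing_add_left:
  assumes "x \<in> lp p" "x' \<in> lp p" "y \<in> lp p"
  shows "pairing (\<lambda>j. x j + x' j) (duality_map p y) =
    pairing x (duality_map p y) + pairing x' (duality_map p y)"
  using pairing_summable[OF assms(1,3)] pairing_summable[OF assms(2,3)]
  by (simp add: pairing_def distrib_right suminf_add)

lemma pairing_restr_right:
  assumes "x \<in> lp p" "y \<in> lp p"
  shows "pairing x (duality_map p y) =
    pairing x (duality_map p (restr S y)) + pairing x (duality_map p (restr (- S) y))"
proof -
  have "duality_map p y j = duality_map p (restr S y) j + duality_map p (restr (- S) y) j" for j
    by (auto simp: duality_map_def restr_def)
  then show ?thesis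
    using pairing_summable[OF assms(1) restr_lp[OF p assms(2)], of S]
      pairing_summable[OF assms(1) restr_lp[OF p assms(2)], of "- S"]
    unfolding pairing_def by (simp add: distrib_left suminf_add)
qed

end

section \<open>Blocks with disjoint supports\<close>

lemma disjoint_blocks_active:
  fixes u :: "nat \<Rightarrow> nat \<Rightarrow> complex" and n j :: nat
  assumes "\<And>k l j. k \<le> n \<Longrightarrow> l \<le> n \<Longrightarrow> k \<noteq> l \<Longrightarrow> u k j = 0 \<or> u l j = 0"
  obtains i where "i \<le> n" "\<And>k. k \<le> n \<Longrightarrow> k \<noteq> i \<Longrightarrow> u k j = 0"
proof (cases "\<exists>i\<le>n. u i j \<noteq> 0")
  case True
  then show ?thesis using that assms by metis
next
  case False
  then show ?thesis using that[of 0] by simp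
qed

lemma sum_single:
  fixes f :: "nat \<Rightarrow> 'a::comm_monoid_add"
  assumes "i \<le> n" "\<And>k. k \<le> n \<Longrightarrow> k \<noteq> i \<Longrightarrow> f k = 0"
  shows "(\<Sum>k\<le>n. f k) = f i"
  using assms by (subst sum.remove[of _ i]) (auto intro!: sum.neutral)

section \<open>The numerical range and normalized restrictions\<close>

lemma lp_operator_bound:
  assumes "lp_operator p T"
  obtains K where "0 \<le> K" "\<And>x. x \<in> lp p \<Longrightarrow> lp_norm p (T x) \<le> K * lp_norm p x"
proof -
  obtain K where K: "\<And>x. x \<in> lp p \<Longrightarrow> lp_norm p (T x) \<le> K * lp_norm p x"
    using assms unfolding lp_operator_def by blast
  have "lp_norm p (T x) \<le> max K 0 * lp_norm p x" if "x \<in> lp p" for x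
    by (rule order_trans[OF K[OF that]]) (auto intro: mult_right_mono simp: lp_norm_def)
  then show ?thesis using that[of "max K 0"] by simp
qed

context
  fixes p :: real and T :: "(nat \<Rightarrow> complex) \<Rightarrow> (nat \<Rightarrow> complex)"
  assumes p: "1 < p" and T: "lp_operator p T"
begin

lemma T_lp: "x \<in> lp p \<Longrightarrow> T x \<in> lp p"
  and T_add: "x \<in> lp p \<Longrightarrow> y \<in> lp p \<Longrightarrow> T (\<lambda>j. x j + y j) = (\<lambda>j. T x j + T y j)"
  and T_scale: "x \<in> lp p \<Longrightarrow> T (\<lambda>j. a * x j) = (\<lambda>j. a * T x j)"
  using T unfolding lp_operator_def by blast+

abbreviation form :: "(nat \<Rightarrow> complex) \<Rightarrow> complex" where
  "form x \<equiv> pairing (T x) (duality_map p x)"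

lemma form_scale:
  assumes "x \<in> lp p" "0 \<le> a"
  shows "form (\<lambda>j. of_real a * x j) = of_real (a powr p) * form x"
proof -
  have "a * a powr (p - 1) = a powr p"
    using assms(2) powr_mult_base[of a "p - 1"] by simp
  then show ?thesis
    using assms by (simp add: T_scale pairing_scale_left[OF p] pairing_scale_right[OF p] T_lp
        lp_scale mult.assoc flip: of_real_mult)
qed

lemma T_restr:
  assumes "x \<in> lp p"
  shows "T x = (\<lambda>j. T (restr S x) j + T (restr (- S) x) j)"
proof -
  have "x = (\<lambda>j. restr S x j + restr (- S) x j)"
    by (auto simp: restr_def)
  then show ?thesis
    using T_add[OF restr_lp[OF p assms] restr_lp[OF p assms], of S "- S"] by simp
qed

text \<open>
  With \<open>x = v + r\<close> split over disjoint supports, \<open>J x = J v + J r\<close>, so the difference is exactly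
  \<open>\<langle>T r, J x\<rangle> + \<langle>T v, J r\<rangle>\<close>, and Hoelder's inequality applies to both terms.
\<close>

lemma form_restr_error:
  assumes K: "0 \<le> K" "\<And>x. x \<in> lp p \<Longrightarrow> lp_norm p (T x) \<le> K * lp_norm p x"
    and x: "x \<in> lp p" "lp_norm p x = 1"
  shows "cmod (form x - form (restr S x)) \<le>
    K * (lp_norm p (restr (- S) x) + lp_norm p (restr (- S) x) powr (p - 1))"
proof -
  let ?v = "restr S x" and ?r = "restr (- S) x"
  have lp: "?v \<in> lp p" "?r \<in> lp p"
    using restr_lp[OF p x(1)] by auto
  have "form x = pairing (T ?v) (duality_map p x) + pairing (T ?r) (duality_map p x)"
    using lp x by (subst T_restr[OF x(1), of S]) (simp add: pairing_add_left[OF p] T_lp)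
  moreover have "pairing (T ?v) (duality_map p x) = form ?v + pairing (T ?v) (duality_map p ?r)"
    using lp x by (intro pairing_restr_right[OF p]) (simp_all add: T_lp)
  ultimately have "form x - form ?v =
      pairing (T ?r) (duality_map p x) + pairing (T ?v) (duality_map p ?r)"
    by simp
  moreover have "cmod (pairing (T ?r) (duality_map p x)) \<le> K * lp_norm p ?r"
    using Holder_pairing[OF p T_lp[OF lp(2)] x(1)] K(2)[OF lp(2)] x(2) by simp
  moreover have "cmod (pairing (T ?v) (duality_map p ?r)) \<le> K * lp_norm p ?r powr (p - 1)"
  proof -
    have "lp_norm p (T ?v) \<le> K"
      using K(2)[OF lp(1)] lp_norm_restr_le[OF p x(1), of S] x(2) K(1)
      by (smt (verit) mult_left_le)
    then have "lp_norm p (T ?v) * lp_norm p ?r powr (p - 1) \<le> K * lp_norm p ?r powr (p - 1)"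
      by (intro mult_right_mono) auto
    then show ?thesis
      using Holder_pairing[OF p T_lp[OF lp(1)] lp(2)] by linarith
  qed
  ultimately show ?thesis
    using norm_triangle_ineq[of "pairing (T ?r) (duality_map p x)" "pairing (T ?v) (duality_map p ?r)"]
    by (simp add: distrib_left)
qed

text \<open>
  This replaces unit vectors by unit vectors with prescribed supports. Cutting off a
  vanishing part changes \<open>form\<close> by a vanishing amount, and the norms of what is left tend to \<open>1\<close>, so that
  normalizing does not change the limit either. Only for large \<open>n\<close> is the restriction certain to be
  nonzero, hence the eventual statement on norms.
\<close>

lemma normalized_restrictions:
  assumes X: "\<And>n. X n \<in> lp p" "\<And>n. lp_norm p (X n) = 1"
    and rest: "(\<lambda>n. lp_norm p (restr (- S n) (X n))) \<longlonglongrightarrow> 0"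
    and lim: "(\<lambda>n. form (X n)) \<longlonglongrightarrow> w"
  obtains V where "\<And>n. V n \<in> lp p" "\<And>n j. j \<notin> S n \<Longrightarrow> V n j = 0"
    "\<forall>\<^sub>F n in sequentially. lp_norm p (V n) = 1" "(\<lambda>n. form (V n)) \<longlonglongrightarrow> w"
    "\<And>j. (\<lambda>n. T (X n) j) \<longlonglongrightarrow> 0 \<Longrightarrow> (\<lambda>n. T (V n) j) \<longlonglongrightarrow> 0"
proof -
  obtain K where K: "0 \<le> K" "\<And>x. x \<in> lp p \<Longrightarrow> lp_norm p (T x) \<le> K * lp_norm p x"
    using lp_operator_bound[OF T] by blast
  define v where "v n = restr (S n) (X n)" for n
  define r where "r n = restr (- S n) (X n)" for n
  define a where "a n = 1 / lp_norm p (v n)" for n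
  define V where "V n = (\<lambda>j. of_real (a n) * v n j)" for n
  have v_lp: "v n \<in> lp p" and r_lp: "r n \<in> lp p" for n
    by (simp_all add: v_def r_def restr_lp[OF p] X)
  have r0: "(\<lambda>n. lp_norm p (r n)) \<longlonglongrightarrow> 0"
    using rest by (simp add: r_def)
  have "(\<lambda>n. lp_norm p (r n) powr p) \<longlonglongrightarrow> 0 powr p"
    using p by (intro tendsto_powr' r0 tendsto_const) (auto simp: lp_norm_nonneg)
  from tendsto_diff[OF tendsto_const this, of 1] have "(\<lambda>n. (1 - lp_norm p (r n) powr p) powr (1 / p)) \<longlonglongrightarrow> (1 - 0 powr p) powr (1 / p)"
    by (intro tendsto_powr tendsto_const) auto
  moreover have "lp_norm p (v n) = (1 - lp_norm p (r n) powr p) powr (1 / p)" for n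
  proof -
    have "mass p (v n) = 1 - mass p (r n)"
      using mass_restr_Compl[OF p X(1), of "S n" n] X(2)[of n] lp_norm_eq_1_iff[OF p X(1)]
      by (simp add: v_def r_def algebra_simps)
    then show ?thesis
      by (simp add: lp_norm_eq_mass[of p "v n"] lp_norm_powr[OF p r_lp])
  qed
  ultimately have v1: "(\<lambda>n. lp_norm p (v n)) \<longlonglongrightarrow> 1"
    using p by simp
  have a1: "a \<longlonglongrightarrow> 1"
    unfolding a_def using tendsto_divide[OF tendsto_const v1, of 1] by simp
  have a_nonneg: "0 \<le> a n" for n
    by (simp add: a_def lp_norm_nonneg)
  have V_lp: "V n \<in> lp p" for n
    unfolding V_def by (rule lp_scale[OF v_lp])
  have norm_V: "\<forall>\<^sub>F n in sequentially. lp_norm p (V n) = 1"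
  proof -
    have "\<forall>\<^sub>F n in sequentially. 0 < lp_norm p (v n)"
      using order_tendstoD(1)[OF v1, of 0] by simp
    then show ?thesis
      by eventually_elim (simp only: V_def lp_norm_scale[OF p v_lp], simp add: a_def norm_divide)
  qed
  have "(\<lambda>n. form (X n) - form (v n)) \<longlonglongrightarrow> 0"
  proof (rule Lim_null_comparison)
    show "\<forall>\<^sub>F n in sequentially. cmod (form (X n) - form (v n)) \<le>
        K * (lp_norm p (r n) + lp_norm p (r n) powr (p - 1))"
      using form_restr_error[OF K X] by (simp add: v_def r_def)
    have "(\<lambda>n. K * (lp_norm p (r n) + lp_norm p (r n) powr (p - 1))) \<longlonglongrightarrow> K * (0 + 0 powr (p - 1))"
      using p r0 by (intro tendsto_mult tendsto_add tendsto_const tendsto_powr')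
        (auto simp: lp_norm_nonneg)
    then show "(\<lambda>n. K * (lp_norm p (r n) + lp_norm p (r n) powr (p - 1))) \<longlonglongrightarrow> 0"
      by simp
  qed
  from tendsto_diff[OF lim this] have form_v: "(\<lambda>n. form (v n)) \<longlonglongrightarrow> w"
    by simp
  have "(\<lambda>n. of_real (a n powr p) * form (v n)) \<longlonglongrightarrow> of_real (1 powr p) * w"
    by (intro tendsto_intros a1 form_v) auto
  then have form_V: "(\<lambda>n. form (V n)) \<longlonglongrightarrow> w"
    by (simp add: V_def form_scale[OF v_lp a_nonneg])
  have T_V: "(\<lambda>n. T (V n) j) \<longlonglongrightarrow> 0" if j: "(\<lambda>n. T (X n) j) \<longlonglongrightarrow> 0" for j
  proof -
    have "(\<lambda>n. T (r n) j) \<longlonglongrightarrow> 0"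
    proof (rule Lim_null_comparison)
      show "\<forall>\<^sub>F n in sequentially. cmod (T (r n) j) \<le> K * lp_norm p (r n)"
        using order_trans[OF norm_coordinate_le[OF p T_lp[OF r_lp]] K(2)[OF r_lp]] by simp
      show "(\<lambda>n. K * lp_norm p (r n)) \<longlonglongrightarrow> 0"
        using tendsto_mult[OF tendsto_const r0, of K] by simp
    qed
    then have "(\<lambda>n. of_real (a n) * (T (X n) j - T (r n) j)) \<longlonglongrightarrow> of_real 1 * (0 - 0)"
      by (intro tendsto_intros a1 j)
    moreover have "T (V n) j = of_real (a n) * (T (X n) j - T (r n) j)" for n
      using fun_cong[OF T_restr[OF X(1)[of n], of "S n"], of j]
      unfolding V_def T_scale[OF v_lp] by (simp add: v_def r_def)
    ultimately show ?thesis by simp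
  qed
  show ?thesis
    by (rule that[of V]) (use V_lp norm_V form_V T_V in \<open>auto simp: V_def v_def restr_def\<close>)
qed

section \<open>Almost decoupled blocks\<close>

lemma numerical_range_finite_support:
  assumes "z \<in> numerical_range p T" "0 < e"
  obtains x N where "\<And>j. N \<le> j \<Longrightarrow> x j = 0" "lp_norm p x = 1" "cmod (form x - z) < e"
proof -
  obtain x where x: "x \<in> lp p" "lp_norm p x = 1" "z = form x"
    using assms(1) by (auto simp: numerical_range_def)
  have "(\<lambda>n. lp_norm p (restr (- {..<n}) x)) \<longlonglongrightarrow> 0"
    using lp_norm_tendsto_0[OF p restr_lp[OF p x(1)] mass_tail_tendsto[OF p x(1)]] by simp
  then show ?thesis
  proof (rule normalized_restrictions[where w = z, rotated 2])
    show "x \<in> lp p" "lp_norm p x = 1" "(\<lambda>n. form x) \<longlonglongrightarrow> z"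
      using x by simp_all
    fix V :: "nat \<Rightarrow> nat \<Rightarrow> complex"
    assume V: "\<And>n j. j \<notin> {..<n} \<Longrightarrow> V n j = 0"
      "\<forall>\<^sub>F n in sequentially. lp_norm p (V n) = 1" "(\<lambda>n. form (V n)) \<longlonglongrightarrow> z"
    have "\<forall>\<^sub>F n in sequentially. lp_norm p (V n) = 1 \<and> cmod (form (V n) - z) < e"
      using V(2) tendstoD[OF V(3) assms(2)] by eventually_elim (simp add: dist_norm)
    then obtain n where "lp_norm p (V n) = 1" "cmod (form (V n) - z) < e"
      by (auto simp: eventually_sequentially)
    then show thesis using that[of n "V n"] V(1) by auto
  qed
qed

text \<open>
  Coordinates of \<open>x\<close> and of \<open>T x\<close> are bounded functionals of \<open>x\<close>. Along a weakly null sequence the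
  first \<open>N\<close> coordinates therefore tend to \<open>0\<close> and may be cut off, as may a tail of each vector.
\<close>

lemma essential_numerical_range_far_blocks:
  assumes "w \<in> essential_numerical_range p T"
  obtains V M where "\<And>n j. j < N \<Longrightarrow> V n j = 0" "\<And>n j. M n \<le> j \<Longrightarrow> V n j = 0"
    "\<forall>\<^sub>F n in sequentially. lp_norm p (V n) = 1" "(\<lambda>n. form (V n)) \<longlonglongrightarrow> w"
    "\<And>j. (\<lambda>n. T (V n) j) \<longlonglongrightarrow> 0"
proof -
  obtain X where X: "\<And>n. X n \<in> lp p" "\<And>n. lp_norm p (X n) = 1"
    and null: "lp_weakly_null p X" and lim: "(\<lambda>n. form (X n)) \<longlonglongrightarrow> w"
    using assms by (auto simp: essential_numerical_range_def)
  obtain K where K: "\<And>x. x \<in> lp p \<Longrightarrow> lp_norm p (T x) \<le> K * lp_norm p x"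
    using lp_operator_bound[OF T] by blast
  have "lp_functional p (\<lambda>x. x j)" for j
    unfolding lp_functional_def using norm_coordinate_le[OF p] by (auto intro!: exI[of _ 1])
  then have X0: "(\<lambda>n. X n j) \<longlonglongrightarrow> 0" for j
    using null unfolding lp_weakly_null_def by blast
  have "lp_functional p (\<lambda>x. T x j)" for j
    unfolding lp_functional_def
    using order_trans[OF norm_coordinate_le[OF p T_lp] K] by (auto simp: T_add T_scale)
  then have TX0: "(\<lambda>n. T (X n) j) \<longlonglongrightarrow> 0" for j
    using null unfolding lp_weakly_null_def by blast
  have "\<exists>m\<ge>N. mass p (restr {m..} (X n)) < 1 / real (Suc n)" for n
  proof -
    have "\<forall>\<^sub>F m in sequentially. mass p (restr {m..} (X n)) < 1 / real (Suc n) \<and> N \<le> m"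
      using order_tendstoD(2)[OF mass_tail_tendsto[OF p X(1)[of n]], of "1 / real (Suc n)"]
        eventually_ge_at_top[of N] by (intro eventually_conj) auto
    then show ?thesis by (auto simp: eventually_sequentially)
  qed
  then obtain M where M: "\<And>n. N \<le> M n" "\<And>n. mass p (restr {M n..} (X n)) < 1 / real (Suc n)"
    by metis
  have split: "- {N..<M n} = {..<N} \<union> {M n..}" for n
    using M(1)[of n] by auto
  have mass_rest: "mass p (restr (- {N..<M n}) (X n)) =
      (\<Sum>j<N. cmod (X n j) powr p) + mass p (restr {M n..} (X n))" for n
    unfolding split using M(1)[of n] by (subst mass_restr_Un[OF p X(1)]) (auto simp: mass_restr_finite[OF p])
  have tail0: "(\<lambda>n. mass p (restr {M n..} (X n))) \<longlonglongrightarrow> 0"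
  proof (rule tendsto_sandwich[OF _ _ tendsto_const LIMSEQ_inverse_real_of_nat])
    show "\<forall>\<^sub>F n in sequentially. 0 \<le> mass p (restr {M n..} (X n))"
      by (simp add: mass_nonneg[OF restr_lp[OF p X(1)]])
    show "\<forall>\<^sub>F n in sequentially. mass p (restr {M n..} (X n)) \<le> inverse (real (Suc n))"
      using less_imp_le[OF M(2)] by (simp add: inverse_eq_divide)
  qed
  have "(\<lambda>n. cmod (X n j) powr p) \<longlonglongrightarrow> 0 powr p" for j
    using p by (intro tendsto_powr' tendsto_norm_zero X0 tendsto_const) auto
  then have "(\<lambda>n. \<Sum>j<N. cmod (X n j) powr p) \<longlonglongrightarrow> (\<Sum>j<N. 0)"
    by (intro tendsto_sum) simp
  from tendsto_add[OF this tail0]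
  have "(\<lambda>n. mass p (restr (- {N..<M n}) (X n))) \<longlonglongrightarrow> 0"
    by (simp add: mass_rest)
  then have "(\<lambda>n. lp_norm p (restr (- {N..<M n}) (X n))) \<longlonglongrightarrow> 0"
    by (rule lp_norm_tendsto_0[OF p restr_lp[OF p X(1)]])
  from X this lim show ?thesis
  proof (rule normalized_restrictions)
    fix V :: "nat \<Rightarrow> nat \<Rightarrow> complex"
    assume V: "\<And>n j. j \<notin> {N..<M n} \<Longrightarrow> V n j = 0"
      "\<forall>\<^sub>F n in sequentially. lp_norm p (V n) = 1" "(\<lambda>n. form (V n)) \<longlonglongrightarrow> w"
      "\<And>j. (\<lambda>n. T (X n) j) \<longlonglongrightarrow> 0 \<Longrightarrow> (\<lambda>n. T (V n) j) \<longlonglongrightarrow> 0"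
    show thesis
      by (rule that[of V M]) (use V(1) in simp, use V(1) in simp, rule V(2), rule V(3), rule V(4), rule TX0)
  qed
qed

text \<open>
  The two cross terms are small for different reasons. For \<open>\<langle>T u\<^sub>k, J v\<rangle>\<close> the block \<open>v\<close> only sees a tail of
  the fixed vector \<open>T u\<^sub>k\<close>; this decides how far out \<open>v\<close> has to start. For \<open>\<langle>T v, J u\<^sub>k\<rangle>\<close> only finitely many
  coordinates of \<open>T v\<close> matter, and these tend to \<open>0\<close> along the sequence from which \<open>v\<close> is taken.
\<close>

lemma next_block:
  assumes w: "w \<in> essential_numerical_range p T" and e: "0 < e"
    and u: "\<And>k j. k \<le> (n::nat) \<Longrightarrow> N \<le> j \<Longrightarrow> u k j = 0"
  obtains v M where "\<And>j. j < N \<Longrightarrow> v j = 0" "\<And>j. M \<le> j \<Longrightarrow> v j = 0" "lp_norm p v = 1"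
    "cmod (form v - w) < e"
    "\<And>k. k \<le> n \<Longrightarrow> cmod (pairing (T (u k)) (duality_map p v)) < e"
    "\<And>k. k \<le> n \<Longrightarrow> cmod (pairing (T v) (duality_map p (u k))) < e"
proof -
  have u_lp: "u k \<in> lp p" if "k \<le> n" for k
    using u[OF that] by (rule finite_support_lp[OF p])
  have "\<forall>\<^sub>F L in sequentially. lp_norm p (restr {L..} (T (u k))) < e" if "k \<le> n" for k
    using order_tendstoD(2)[OF lp_norm_tendsto_0[OF p restr_lp[OF p T_lp] mass_tail_tendsto[OF p T_lp]] e]
      u_lp[OF that] by blast
  then have "\<forall>\<^sub>F L in sequentially. \<forall>k\<in>{..n}. lp_norm p (restr {L..} (T (u k))) < e"
    by (intro eventually_ball_finite) auto
  then have "\<forall>\<^sub>F L in sequentially. (\<forall>k\<in>{..n}. lp_norm p (restr {L..} (T (u k))) < e) \<and> N \<le> L"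
    using eventually_ge_at_top[of N] by (rule eventually_conj)
  then obtain L where L: "N \<le> L" "\<And>k. k \<le> n \<Longrightarrow> lp_norm p (restr {L..} (T (u k))) < e"
    by (auto simp: eventually_sequentially)
  show ?thesis
  proof (rule essential_numerical_range_far_blocks[OF w, of L])
    fix V :: "nat \<Rightarrow> nat \<Rightarrow> complex" and M
    assume V: "\<And>m j. j < L \<Longrightarrow> V m j = 0" "\<And>m j. M m \<le> j \<Longrightarrow> V m j = 0"
      and ev1: "\<forall>\<^sub>F m in sequentially. lp_norm p (V m) = 1" and lim: "(\<lambda>m. form (V m)) \<longlonglongrightarrow> w"
      and TV: "\<And>j. (\<lambda>m. T (V m) j) \<longlonglongrightarrow> 0"
    have "\<forall>\<^sub>F m in sequentially. cmod (pairing (T (V m)) (duality_map p (u k))) < e" if "k \<le> n" for k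
    proof -
      have "(\<lambda>m. \<Sum>j<N. T (V m) j * cnj (duality_map p (u k) j)) \<longlonglongrightarrow>
          (\<Sum>j<N. 0 * cnj (duality_map p (u k) j))"
        by (intro tendsto_intros TV)
      then have "(\<lambda>m. pairing (T (V m)) (duality_map p (u k))) \<longlonglongrightarrow> 0"
        by (simp add: pairing_finite_support[OF u[OF that]])
      from tendstoD[OF this e] show ?thesis by simp
    qed
    then have "\<forall>\<^sub>F m in sequentially. \<forall>k\<in>{..n}. cmod (pairing (T (V m)) (duality_map p (u k))) < e"
      by (intro eventually_ball_finite) auto
    with ev1 tendstoD[OF lim e]
    have "\<forall>\<^sub>F m in sequentially. lp_norm p (V m) = 1 \<and> cmod (form (V m) - w) < e \<and>
        (\<forall>k\<in>{..n}. cmod (pairing (T (V m)) (duality_map p (u k))) < e)"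
      by eventually_elim (simp add: dist_norm)
    then obtain m where m: "lp_norm p (V m) = 1" "cmod (form (V m) - w) < e"
      "\<And>k. k \<le> n \<Longrightarrow> cmod (pairing (T (V m)) (duality_map p (u k))) < e"
      by (auto simp: eventually_sequentially)
    have V_lp: "V m \<in> lp p" for m
      by (rule finite_support_lp[OF p, of "M m"]) (rule V(2))
    have "cmod (pairing (T (u k)) (duality_map p (V m))) < e" if k: "k \<le> n" for k
    proof -
      have "V m = restr {L..} (V m)"
        using V(1) by (auto simp: restr_def fun_eq_iff)
      then have "pairing (T (u k)) (duality_map p (V m)) =
          pairing (restr {L..} (T (u k))) (duality_map p (V m))"
        by (metis pairing_restr_left)
      also have "cmod \<dots> \<le> lp_norm p (restr {L..} (T (u k)))"
        using Holder_pairing[OF p restr_lp[OF p T_lp[OF u_lp[OF k]]] V_lp[of m]] m(1) by simp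
      finally show ?thesis using L(2)[OF k] by linarith
    qed
    then show thesis
      using that[of "V m" "M m"] V m L(1) by auto
  qed
qed

text \<open>
  The blocks are chosen one after the other, each beyond the supports of all earlier ones. The bound on
  the entrywise distance of the matrix of pairings from the diagonal matrix of the points \<open>w k\<close> covers
  the values of \<open>form\<close> and the cross terms at once.
\<close>

lemma almost_decoupled_blocks:
  assumes w: "w 0 \<in> numerical_range p T" "\<And>k. w (Suc k) \<in> essential_numerical_range p T"
    and e: "0 < e"
  obtains u N where "\<And>k j. k \<le> n \<Longrightarrow> N \<le> j \<Longrightarrow> u k j = 0" "\<And>k. k \<le> n \<Longrightarrow> lp_norm p (u k) = 1"
    "\<And>k l j. k \<le> n \<Longrightarrow> l \<le> n \<Longrightarrow> k \<noteq> l \<Longrightarrow> u k j = 0 \<or> u l j = 0"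
    "\<And>k l. k \<le> n \<Longrightarrow> l \<le> n \<Longrightarrow>
      cmod (pairing (T (u k)) (duality_map p (u l)) - (if k = l then w k else 0)) < e"
proof (induction n arbitrary: thesis)
  case 0
  obtain x N where "\<And>j. N \<le> j \<Longrightarrow> x j = 0" "lp_norm p x = 1" "cmod (form x - w 0) < e"
    using numerical_range_finite_support[OF w(1) e] by blast
  then show ?case using 0[of N "\<lambda>k. x"] by simp
next
  case (Suc n)
  show ?case
  proof (rule Suc.IH)
    fix N u
    assume u: "\<And>k j. k \<le> n \<Longrightarrow> N \<le> j \<Longrightarrow> u k j = 0" "\<And>k. k \<le> n \<Longrightarrow> lp_norm p (u k) = 1"
      "\<And>k l j. k \<le> n \<Longrightarrow> l \<le> n \<Longrightarrow> k \<noteq> l \<Longrightarrow> u k j = 0 \<or> u l j = 0"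
      "\<And>k l. k \<le> n \<Longrightarrow> l \<le> n \<Longrightarrow>
        cmod (pairing (T (u k)) (duality_map p (u l)) - (if k = l then w k else 0)) < e"
    show ?case
    proof (rule next_block[of "w (Suc n)" e n N u])
      show "w (Suc n) \<in> essential_numerical_range p T" "0 < e"
        by (rule w(2), rule e)
      show "u k j = 0" if "k \<le> n" "N \<le> j" for k j
        using that by (rule u(1))
      fix v M
      assume v: "\<And>j. j < N \<Longrightarrow> v j = 0" "\<And>j. M \<le> j \<Longrightarrow> v j = 0" "lp_norm p v = 1"
        "cmod (form v - w (Suc n)) < e"
        "\<And>k. k \<le> n \<Longrightarrow> cmod (pairing (T (u k)) (duality_map p v)) < e"
        "\<And>k. k \<le> n \<Longrightarrow> cmod (pairing (T v) (duality_map p (u k))) < e"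
      have disj: "u k j = 0 \<or> v j = 0" if "k \<le> n" for k j
        using u(1)[OF that, of j] v(1)[of j] by linarith
      define u' where "u' = u(Suc n := v)"
      show ?case
      proof (rule Suc.prems[of "max N M" u'])
        show "u' k j = 0" if "k \<le> Suc n" "max N M \<le> j" for k j
          using that u(1) v(2) by (auto simp: u'_def le_Suc_eq)
        show "lp_norm p (u' k) = 1" if "k \<le> Suc n" for k
          using that u(2) v(3) by (auto simp: u'_def le_Suc_eq)
        show "u' k j = 0 \<or> u' l j = 0" if "k \<le> Suc n" "l \<le> Suc n" "k \<noteq> l" for k l j
          using that u(3)[of k l j] disj[of k j] disj[of l j] by (auto simp: u'_def le_Suc_eq)
        show "cmod (pairing (T (u' k)) (duality_map p (u' l)) - (if k = l then w k else 0)) < e"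
          if "k \<le> Suc n" "l \<le> Suc n" for k l
          using that u(4)[of k l] v(4,5,6) by (auto simp: u'_def le_Suc_eq)
      qed
    qed
  qed
qed

section \<open>The form on combinations of disjoint blocks\<close>

context
  fixes u :: "nat \<Rightarrow> nat \<Rightarrow> complex" and N n :: nat and a :: "nat \<Rightarrow> real" and y :: "nat \<Rightarrow> complex"
  assumes supp: "\<And>k j. k \<le> n \<Longrightarrow> N \<le> j \<Longrightarrow> u k j = 0"
    and disj: "\<And>k l j. k \<le> n \<Longrightarrow> l \<le> n \<Longrightarrow> k \<noteq> l \<Longrightarrow> u k j = 0 \<or> u l j = 0"
    and a: "\<And>k. 0 \<le> a k"
  defines "y \<equiv> (\<lambda>j. \<Sum>k\<le>n. of_real (a k) * u k j)"
begin

lemma block_lp: "k \<le> n \<Longrightarrow> u k \<in> lp p"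
  by (rule finite_support_lp[OF p, of N]) (simp add: supp)

lemma combination_lp: "y \<in> lp p"
  by (rule finite_support_lp[OF p, of N]) (simp add: y_def supp)

lemma mass_combination: "mass p y = (\<Sum>k\<le>n. a k powr p * mass p (u k))"
proof -
  have "cmod (y j) powr p = (\<Sum>k\<le>n. a k powr p * cmod (u k j) powr p)" for j
  proof -
    obtain i where i: "i \<le> n" "\<And>k. k \<le> n \<Longrightarrow> k \<noteq> i \<Longrightarrow> u k j = 0"
      using disjoint_blocks_active[of n u j] disj by blast
    have "y j = of_real (a i) * u i j"
      unfolding y_def using i by (intro sum_single) auto
    moreover have "(\<Sum>k\<le>n. a k powr p * cmod (u k j) powr p) = a i powr p * cmod (u i j) powr p"
      using i by (intro sum_single) auto
    ultimately show ?thesis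
      using a by (simp add: norm_mult powr_mult)
  qed
  then have "mass p y = (\<Sum>j. \<Sum>k\<le>n. a k powr p * cmod (u k j) powr p)"
    by (simp add: mass_def)
  also have "\<dots> = (\<Sum>k\<le>n. \<Sum>j. a k powr p * cmod (u k j) powr p)"
    using block_lp by (intro suminf_sum summable_mult) (simp add: lp_def)
  also have "\<dots> = (\<Sum>k\<le>n. a k powr p * mass p (u k))"
    unfolding mass_def using block_lp by (intro sum.cong refl suminf_mult) (simp add: lp_def)
  finally show ?thesis .
qed

lemma T_combination: "T y = (\<lambda>j. \<Sum>k\<le>n. of_real (a k) * T (u k) j)"
proof -
  have "T (\<lambda>j. \<Sum>k\<le>m. of_real (a k) * u k j) = (\<lambda>j. \<Sum>k\<le>m. of_real (a k) * T (u k) j)"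
    if "m \<le> n" for m
    using that
  proof (induction m)
    case 0
    then show ?case using T_scale[OF block_lp] by simp
  next
    case (Suc m)
    have "(\<lambda>j. \<Sum>k\<le>m. of_real (a k) * u k j) \<in> lp p"
      using Suc.prems by (intro finite_support_lp[OF p, of N]) (simp add: supp)
    then show ?case
      using Suc T_add[OF _ lp_scale[OF block_lp[OF Suc.prems]]] T_scale[OF block_lp[OF Suc.prems]]
      by simp
  qed
  then show ?thesis by (simp add: y_def)
qed

lemma duality_map_combination:
  "duality_map p y j = (\<Sum>k\<le>n. of_real (a k powr (p - 1)) * duality_map p (u k) j)"
proof -
  obtain i where i: "i \<le> n" "\<And>k. k \<le> n \<Longrightarrow> k \<noteq> i \<Longrightarrow> u k j = 0"
    using disjoint_blocks_active[of n u j] disj by blast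
  have "y j = of_real (a i) * u i j"
    unfolding y_def using i by (intro sum_single) auto
  then have "duality_map p y j = duality_map p (\<lambda>j. of_real (a i) * u i j) j"
    by (simp add: duality_map_def)
  also have "\<dots> = of_real (a i powr (p - 1)) * duality_map p (u i) j"
    by (rule duality_map_scale[OF a])
  also have "\<dots> = (\<Sum>k\<le>n. of_real (a k powr (p - 1)) * duality_map p (u k) j)"
    using i by (intro sum_single[symmetric]) (auto simp: duality_map_def)
  finally show ?thesis .
qed

lemma form_combination:
  "form y = (\<Sum>k\<le>n. \<Sum>l\<le>n. of_real (a k * a l powr (p - 1)) * pairing (T (u k)) (duality_map p (u l)))"
proof -
  have "T y j * cnj (duality_map p y j) =
      (\<Sum>k\<le>n. \<Sum>l\<le>n. of_real (a k * a l powr (p - 1)) * (T (u k) j * cnj (duality_map p (u l) j)))" for j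
    unfolding T_combination duality_map_combination by (simp add: sum_product mult_ac)
  then have "form y = (\<Sum>j. \<Sum>k\<le>n. \<Sum>l\<le>n.
      of_real (a k * a l powr (p - 1)) * (T (u k) j * cnj (duality_map p (u l) j)))"
    by (simp add: pairing_def)
  also have "\<dots> = (\<Sum>k\<le>n. \<Sum>j. \<Sum>l\<le>n.
      of_real (a k * a l powr (p - 1)) * (T (u k) j * cnj (duality_map p (u l) j)))"
    by (intro suminf_sum summable_sum summable_mult pairing_summable[OF p T_lp[OF block_lp] block_lp]) auto
  also have "\<dots> = (\<Sum>k\<le>n. \<Sum>l\<le>n. \<Sum>j.
      of_real (a k * a l powr (p - 1)) * (T (u k) j * cnj (duality_map p (u l) j)))"
    by (intro sum.cong refl suminf_sum summable_mult
        pairing_summable[OF p T_lp[OF block_lp] block_lp]) auto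
  also have "\<dots> = (\<Sum>k\<le>n. \<Sum>l\<le>n.
      of_real (a k * a l powr (p - 1)) * pairing (T (u k)) (duality_map p (u l)))"
    unfolding pairing_def
    by (intro sum.cong refl suminf_mult pairing_summable[OF p T_lp[OF block_lp] block_lp]) auto
  finally show ?thesis .
qed

end

section \<open>Attaining convex combinations exactly\<close>

text \<open>
  The weights \<open>s\<close> are a continuous right inverse, on a disc around \<open>c\<close>, of the map that takes weights to
  convex combinations of the points \<open>w k\<close>. If \<open>y v\<close> is the combination of almost decoupled blocks with
  weights \<open>s k v\<close>, then \<open>form (y v) = v + E v\<close> with \<open>E\<close> continuous and bounded by the radius. By Brouwer's
  theorem \<open>v \<mapsto> c - E v\<close> has a fixed point in the disc, and there \<open>form (y v) = c\<close>.
\<close>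

lemma convex_combination_in_numerical_range:
  assumes w: "w 0 \<in> numerical_range p T" "\<And>k. w (Suc k) \<in> essential_numerical_range p T"
    and \<rho>: "0 < \<rho>"
    and cont: "\<And>k. continuous_on (cball c \<rho>) (s k)"
    and nonneg: "\<And>k v. v \<in> cball c \<rho> \<Longrightarrow> 0 \<le> s k v"
    and sum1: "\<And>v. v \<in> cball c \<rho> \<Longrightarrow> (\<Sum>k\<le>n. s k v) = 1"
    and bary: "\<And>v. v \<in> cball c \<rho> \<Longrightarrow> (\<Sum>k\<le>n. of_real (s k v) * w k) = v"
  shows "c \<in> numerical_range p T"
proof -
  \<comment> \<open>There are \<open>(n + 1)\<^sup>2\<close> error terms, which together must not exceed \<open>\<rho>\<close>.\<close>
  define e where "e = \<rho> / (real (Suc n))\<^sup>2"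
  have e: "0 < e" using \<rho> by (simp add: e_def)
  show ?thesis
  proof (rule almost_decoupled_blocks[OF w e, of n])
    fix u N
    assume u: "\<And>k j. k \<le> n \<Longrightarrow> N \<le> j \<Longrightarrow> u k j = 0" "\<And>k. k \<le> n \<Longrightarrow> lp_norm p (u k) = 1"
      "\<And>k l j. k \<le> n \<Longrightarrow> l \<le> n \<Longrightarrow> k \<noteq> l \<Longrightarrow> u k j = 0 \<or> u l j = 0"
      "\<And>k l. k \<le> n \<Longrightarrow> l \<le> n \<Longrightarrow>
        cmod (pairing (T (u k)) (duality_map p (u l)) - (if k = l then w k else 0)) < e"
    define D where "D k l = pairing (T (u k)) (duality_map p (u l)) - (if k = l then w k else 0)" for k l
    define a where "a v k = s k v powr (1 / p)" for v k
    define y where "y v = (\<lambda>j. \<Sum>k\<le>n. of_real (a v k) * u k j)" for v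
    define b where "b v k l = a v k * a v l powr (p - 1)" for v k l
    have a: "0 \<le> a v k" for v k
      by (simp add: a_def)
    have a_p: "a v k powr p = s k v" if "v \<in> cball c \<rho>" for v k
      using p nonneg[OF that] by (simp add: a_def powr_powr)
    have a_le: "a v k \<le> 1" if v: "v \<in> cball c \<rho>" and k: "k \<le> n" for v k
    proof -
      have "s k v \<le> 1"
        using member_le_sum[of k "{..n}" "\<lambda>k. s k v"] nonneg[OF v] sum1[OF v] k by simp
      then show ?thesis
        using p nonneg[OF v] by (simp add: a_def powr_le1)
    qed
    have b_diag: "b v k k = s k v" if "v \<in> cball c \<rho>" for v k
      using a_p[OF that] a[of v k] powr_mult_base[of "a v k" "p - 1"] by (simp add: b_def)
    have b_le: "\<bar>b v k l\<bar> \<le> 1" if "v \<in> cball c \<rho>" "k \<le> n" "l \<le> n" for v k l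
      using p a a_le[OF that(1)] that by (simp add: b_def abs_mult mult_le_one powr_le1)
    have y_lp: "y v \<in> lp p" for v
      unfolding y_def by (rule combination_lp[of n N u "a v"]) (use u a in auto)
    have y_norm: "lp_norm p (y v) = 1" if v: "v \<in> cball c \<rho>" for v
    proof -
      have "mass p (y v) = (\<Sum>k\<le>n. a v k powr p * mass p (u k))"
        unfolding y_def by (rule mass_combination[of n N u "a v"]) (use u a in auto)
      also have "\<dots> = (\<Sum>k\<le>n. s k v)"
        using u(2) lp_norm_eq_1_iff[OF p finite_support_lp[OF p u(1)]] a_p[OF v] by simp
      finally show ?thesis
        using sum1[OF v] lp_norm_eq_1_iff[OF p y_lp] by simp
    qed
    have form_y: "form (y v) = v + (\<Sum>k\<le>n. \<Sum>l\<le>n. of_real (b v k l) * D k l)" if v: "v \<in> cball c \<rho>" for v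
    proof -
      have "form (y v) = (\<Sum>k\<le>n. \<Sum>l\<le>n. of_real (b v k l) * pairing (T (u k)) (duality_map p (u l)))"
        unfolding y_def b_def by (rule form_combination[of n N u "a v"]) (use u a in auto)
      also have "\<dots> = (\<Sum>k\<le>n. \<Sum>l\<le>n. (if k = l then of_real (b v k l) * w k else 0) + of_real (b v k l) * D k l)"
        by (intro sum.cong refl) (simp add: D_def algebra_simps)
      also have "\<dots> = (\<Sum>k\<le>n. of_real (b v k k) * w k) + (\<Sum>k\<le>n. \<Sum>l\<le>n. of_real (b v k l) * D k l)"
        by (simp add: sum.distrib)
      finally show ?thesis
        using bary[OF v] b_diag[OF v] by simp
    qed
    define g where "g v = c - (\<Sum>k\<le>n. \<Sum>l\<le>n. of_real (b v k l) * D k l)" for v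
    have a_cont: "continuous_on (cball c \<rho>) (\<lambda>v. a v k)" for k
      unfolding a_def using p nonneg by (intro continuous_on_powr' cont continuous_on_const) auto
    have b_cont: "continuous_on (cball c \<rho>) (\<lambda>v. b v k l)" for k l
      unfolding b_def using p a
      by (intro continuous_on_mult continuous_on_powr' a_cont continuous_on_const) auto
    have "continuous_on (cball c \<rho>) g"
      unfolding g_def by (intro continuous_intros b_cont)
    moreover have "g v \<in> cball c \<rho>" if v: "v \<in> cball c \<rho>" for v
    proof -
      have "cmod (of_real (b v k l) * D k l) \<le> e" if "k \<le> n" "l \<le> n" for k l
        using mult_mono[OF b_le[OF v that] less_imp_le[OF u(4)[OF that]]]
        by (simp add: norm_mult D_def)
      then have "cmod (\<Sum>k\<le>n. \<Sum>l\<le>n. of_real (b v k l) * D k l) \<le> (\<Sum>k\<le>n. \<Sum>l\<le>n. e)"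
        by (intro order_trans[OF norm_sum] sum_mono) auto
      also have "\<dots> = \<rho>"
        by (simp add: e_def power2_eq_square)
      finally show ?thesis by (simp add: g_def dist_norm)
    qed
    ultimately obtain v where v: "v \<in> cball c \<rho>" "g v = v"
      using brouwer_ball[OF \<rho>, of c g] by blast
    then have "form (y v) = c"
      using form_y[OF v(1)] by (simp add: g_def algebra_simps)
    then show ?thesis
      unfolding numerical_range_def using y_lp y_norm[OF v(1)] by blast
  qed
qed

lemma numerical_range_nonempty: "numerical_range p T \<noteq> {}"
proof -
  let ?x = "\<lambda>j::nat. if j = 0 then 1 else 0 :: complex"
  have x: "?x \<in> lp p"
    by (rule finite_support_lp[OF p, of 1]) simp
  have "mass p ?x = 1"
    using mass_restr_finite[OF p, of "{0}" "\<lambda>j. 1"] by (simp add: restr_def)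
  then show ?thesis
    using x lp_norm_eq_1_iff[OF p x] by (auto simp: numerical_range_def)
qed

text \<open>
  For the corners \<open>c + \<epsilon> \<i>\<^bsup>k\<^esup>\<close> the weights \<open>1 / 4 + Re (cnj (\<i>\<^bsup>k\<^esup>) d) / (2 \<epsilon>)\<close> sum to \<open>1\<close> and represent \<open>c + d\<close>; they
  are nonnegative for \<open>\<bar>d\<bar> \<le> \<epsilon> / 2\<close>. Giving \<open>z\<close> the constant weight \<open>t\<close> and scaling the others by \<open>1 - t\<close>, a
  disc of positive radius around the target is covered as soon as \<open>t < 1\<close>.
\<close>

lemma segment_to_interior_point:
  assumes c: "c \<in> interior (essential_numerical_range p T)" and z: "z \<in> numerical_range p T"
    and t: "0 \<le> t" "t < 1"
  shows "(1 - of_real t) * c + of_real t * z \<in> numerical_range p T"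
proof -
  obtain \<epsilon> where \<epsilon>: "0 < \<epsilon>" "cball c \<epsilon> \<subseteq> essential_numerical_range p T"
    using c unfolding mem_interior_cball by blast
  define m where "m = (1 - of_real t) * c + of_real t * z"
  define w where "w = (\<lambda>k::nat. if k = 0 then z else c + of_real \<epsilon> * \<i> ^ k)"
  define d where "d v = (v - m) / of_real (1 - t)" for v
  define q where "q k v = (if k = 0 then t else (1 - t) * (1 / 4 + Re (cnj (\<i> ^ k) * d v) / (2 * \<epsilon>)))"
    for k :: nat and v
  have ball: "cmod (d v) \<le> \<epsilon> / 2" if "v \<in> cball m ((1 - t) * \<epsilon> / 2)" for v
  proof -
    have "cmod (d v) = dist m v / (1 - t)"
      using t unfolding d_def norm_divide norm_of_real by (simp add: dist_norm norm_minus_commute)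
    also have "\<dots> \<le> ((1 - t) * \<epsilon> / 2) / (1 - t)"
      using that t by (intro divide_right_mono) auto
    also have "\<dots> = \<epsilon> / 2"
      using t by (simp add: field_simps)
    finally show ?thesis .
  qed
  show ?thesis
    unfolding m_def[symmetric]
  proof (rule convex_combination_in_numerical_range[of w "(1 - t) * \<epsilon> / 2" m q 4])
    show "w 0 \<in> numerical_range p T"
      using z by (simp add: w_def)
    show "w (Suc k) \<in> essential_numerical_range p T" for k
      using \<epsilon> by (intro subsetD[OF \<epsilon>(2)]) (simp add: w_def dist_norm norm_mult norm_power)
    show "0 < (1 - t) * \<epsilon> / 2"
      using t \<epsilon> by simp
    show "continuous_on (cball m ((1 - t) * \<epsilon> / 2)) (q k)" for k
    proof (cases "k = 0")
      case False
      then have "q k = (\<lambda>v. (1 - t) * (1 / 4 + Re (cnj (\<i> ^ k) * ((v - m) / of_real (1 - t))) / (2 * \<epsilon>)))"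
        by (simp add: q_def fun_eq_iff d_def)
      moreover have "of_real (1 - t) \<noteq> (0::complex)" "2 * \<epsilon> \<noteq> 0"
        using t \<epsilon>(1) by (simp_all del: of_real_diff)
      ultimately show ?thesis
        by (simp only:) (intro continuous_intros, simp_all)
    qed (simp add: q_def[abs_def])
    show "0 \<le> q k v" if "v \<in> cball m ((1 - t) * \<epsilon> / 2)" for k v
    proof -
      have "\<bar>Re (cnj (\<i> ^ k) * d v)\<bar> \<le> cmod (d v)"
        using abs_Re_le_cmod[of "cnj (\<i> ^ k) * d v"] by (simp add: norm_mult norm_power)
      then have "- (\<epsilon> / 2) \<le> Re (cnj (\<i> ^ k) * d v)"
        using ball[OF that] by linarith
      then have "0 \<le> 1 / 4 + Re (cnj (\<i> ^ k) * d v) / (2 * \<epsilon>)"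
        using \<epsilon>(1) by (simp add: field_simps)
      then show ?thesis using t by (simp add: q_def)
    qed
    have atMost4: "{..4::nat} = {0, 1, 2, 3, 4}" by auto
    have i_powers: "\<i> ^ 3 = -\<i>" "\<i> ^ 4 = 1"
      by (simp_all add: eval_nat_numeral)
    show "(\<Sum>k\<le>4. q k v) = 1" for v
      by (simp add: atMost4 q_def power3_eq_cube power4_eq_xxxx field_simps)
    show "(\<Sum>k\<le>4. of_real (q k v) * w k) = v" for v
    proof -
      have v: "v = m + of_real (1 - t) * d v"
        using t by (simp add: d_def)
      have "(\<Sum>k\<le>4. of_real (q k v) * w k) = of_real t * z + of_real (1 - t) * (c + d v)"
      proof -
        define A B where "A = Re (d v) / (2 * \<epsilon>)" and "B = Im (d v) / (2 * \<epsilon>)"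
        have dv: "d v = of_real (2 * \<epsilon>) * (of_real A + \<i> * of_real B)"
          using \<epsilon>(1) by (simp add: complex_eq_iff A_def B_def)
        have q: "q 0 v = t" "q 1 v = (1 - t) * (1 / 4 + B)" "q 2 v = (1 - t) * (1 / 4 - A)"
          "q 3 v = (1 - t) * (1 / 4 - B)" "q 4 v = (1 - t) * (1 / 4 + A)"
          by (simp_all add: q_def i_powers A_def B_def)
        have w: "w 0 = z" "w 1 = c + of_real \<epsilon> * \<i>" "w 2 = c - of_real \<epsilon>"
          "w 3 = c - of_real \<epsilon> * \<i>" "w 4 = c + of_real \<epsilon>"
          by (simp_all add: w_def i_powers)
        have "(\<Sum>k\<le>4. of_real (q k v) * w k) = of_real (q 0 v) * w 0 + of_real (q 1 v) * w 1 +
            of_real (q 2 v) * w 2 + of_real (q 3 v) * w 3 + of_real (q 4 v) * w 4"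
          by (simp add: atMost4)
        also have "\<dots> = of_real t * z + of_real (1 - t) * (c + d v)"
          unfolding q w dv by (simp add: field_simps)
        finally show ?thesis .
      qed
      also have "\<dots> = v"
        by (subst v) (simp add: m_def algebra_simps)
      finally show ?thesis .
    qed
  qed
qed

end

theorem theorem3p20:
  fixes p :: real and T :: "(nat \<Rightarrow> complex) \<Rightarrow> (nat \<Rightarrow> complex)"
  assumes "1 < p" and "lp_operator p T"
  shows "(interior (essential_numerical_range p T) \<noteq> {} \<longrightarrow> starlike (numerical_range p T)) \<and>
         (\<forall>c \<in> interior (essential_numerical_range p T). star_centre c (numerical_range p T))"
proof -
  have "star_centre c (numerical_range p T)" if c: "c \<in> interior (essential_numerical_range p T)" for c
  proof -
    have segment: "(1 - of_real t) * c + of_real t * z \<in> numerical_range p T"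
      if "z \<in> numerical_range p T" "t \<in> {0..1}" for z and t :: real
      using segment_to_interior_point[OF assms c that(1), of t] that by (cases "t = 1") auto
    then have "c \<in> numerical_range p T"
      using numerical_range_nonempty[OF assms] segment[of _ 0] by auto
    with segment show ?thesis by (simp add: star_centre_def)
  qed
  then show ?thesis
    by (auto simp: starlike_iff_star_centre)
qed

end
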